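(* Let $(M^n,g)$ be an extended quasi-Einstein manifold with generators $U,V,T$ and with associated scalars $a,b,c$ that are constants. If $U$, $V$ and $T$ are Killing vector fields, then $(M^n,g)$ has cyclic parallel Ricci tensor, that is, $$(\nabla_X\mathrm{Ric})(Y,Z)+(\nabla_Y\mathrm{Ric})(Z,X)+(\nabla_Z\mathrm{Ric})(X,Y)=0$$ for all smooth vector fields $X,Y,Z$ on $M$.
   Context: A non-flat Riemannian manifold $(M^n,g)$, $n\ge 3$, is called an extended quasi-Einstein manifold if its Ricci tensor is not identically zero and satisfies $$\mathrm{Ric}(X,Y)=a\,g(X,Y)+b\,A(X)A(Y)+c\,(B(X)D(Y)+D(X)B(Y))$$ for all smooth vector fields $X,Y$, where $a,b,c$ are scalars (the associated scalars) with $c\neq 0$, and $A,B,D$ are non-zero $1$-forms with $A(X)=g(X,U)$, $B(X)=g(X,V)$, $D(X)=g(X,T)$ for mutually orthogonal unit smooth vector fields $U,V,T$ (the generators). $\nabla$ is the Levi-Civita connection. *)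

theory Defs
  imports "HOL-Analysis.Analysis"
begin

section \<open>Smooth manifolds\<close>

text \<open>The derivative along a fixed vector \<open>v\<close> is required to be of class \<open>C^k\<close> for every \<open>v\<close>;
  on a finite-dimensional space this is the usual notion of class \<open>C^(k+1)\<close>. The definition is
  meant for open \<open>S\<close>.\<close>

primrec class_C :: "nat \<Rightarrow> 'b::real_normed_vector set \<Rightarrow> ('b \<Rightarrow> 'c::real_normed_vector) \<Rightarrow> bool" where
  "class_C 0 S f \<longleftrightarrow> continuous_on S f"
| "class_C (Suc k) S f \<longleftrightarrow> (\<forall>x\<in>S. f differentiable (at x)) \<and>
     (\<forall>v. class_C k S (\<lambda>x. frechet_derivative f (at x) v))"

definition smooth_map_on :: "'b::real_normed_vector set \<Rightarrow> ('b \<Rightarrow> 'c::real_normed_vector) \<Rightarrow> bool" where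
  "smooth_map_on S f \<longleftrightarrow> (\<forall>k. class_C k S f)"

type_synonym ('a, 'n) chart = "'a set \<times> ('a \<Rightarrow> real ^ 'n)"

record ('a, 'n::finite) manifold_data =
  base :: "'a topology"
  atlas :: "('a, 'n) chart set"

abbreviation points :: "('a, 'n::finite) manifold_data \<Rightarrow> 'a set" where
  "points M \<equiv> topspace (base M)"

definition smooth_manifold :: "('a, 'n::finite) manifold_data \<Rightarrow> bool" where
  "smooth_manifold M \<longleftrightarrow>
     Hausdorff_space (base M) \<and> second_countable (base M) \<and>
     (\<Union>(W, \<phi>)\<in>atlas M. W) = points M \<and>
     (\<forall>(W, \<phi>)\<in>atlas M.
        openin (base M) W \<and> open (\<phi> ` W) \<and>
        homeomorphic_map (subtopology (base M) W) (top_of_set (\<phi> ` W)) \<phi>) \<and>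
     (\<forall>(W, \<phi>)\<in>atlas M. \<forall>(W', \<psi>)\<in>atlas M.
        smooth_map_on (\<phi> ` (W \<inter> W')) (\<psi> \<circ> inv_into W \<phi>))"

text \<open>The values of \<open>f\<close> outside of the manifold are irrelevant.\<close>

definition smooth_functions :: "('a, 'n::finite) manifold_data \<Rightarrow> ('a \<Rightarrow> real) set" where
  "smooth_functions M =
     {f. \<forall>(W, \<phi>)\<in>atlas M. smooth_map_on (\<phi> ` W) (f \<circ> inv_into W \<phi>)}"


section \<open>Tangent vectors and vector fields\<close>

type_synonym 'a tangent = "('a \<Rightarrow> real) \<Rightarrow> real"
type_synonym 'a vector_field = "'a \<Rightarrow> 'a tangent"

text \<open>Tangent vectors are derivations of the algebra of smooth functions. In order that equality of
  tangent vectors is equality of HOL functions, they are extended by 0 to non-smooth functions.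
  By the product rule a derivation at \<open>p\<close> does not depend on the values of a
  smooth function outside of the manifold (a smooth \<open>h\<close> that vanishes on the manifold is the product
  of \<open>h\<close> with the indicator function of the complement).\<close>

definition tangent_space :: "('a, 'n::finite) manifold_data \<Rightarrow> 'a \<Rightarrow> 'a tangent set" where
  "tangent_space M p =
     {v. (\<forall>f. f \<notin> smooth_functions M \<longrightarrow> v f = 0) \<and>
         (\<forall>f\<in>smooth_functions M. \<forall>h\<in>smooth_functions M. \<forall>r s.
            v (\<lambda>q. r * f q + s * h q) = r * v f + s * v h) \<and>
         (\<forall>f\<in>smooth_functions M. \<forall>h\<in>smooth_functions M.
            v (\<lambda>q. f q * h q) = f p * v h + h p * v f)}"

definition deriv_along :: "'a vector_field \<Rightarrow> ('a \<Rightarrow> real) \<Rightarrow> 'a \<Rightarrow> real" where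
  "deriv_along X f = (\<lambda>p. X p f)"

text \<open>Smooth vector fields, extended by 0 outside of the manifold.\<close>

definition vector_fields :: "('a, 'n::finite) manifold_data \<Rightarrow> 'a vector_field set" where
  "vector_fields M =
     {X. (\<forall>p\<in>points M. X p \<in> tangent_space M p) \<and>
         (\<forall>p. p \<notin> points M \<longrightarrow> X p = (\<lambda>f. 0)) \<and>
         (\<forall>f\<in>smooth_functions M. deriv_along X f \<in> smooth_functions M)}"

definition field_add :: "'a vector_field \<Rightarrow> 'a vector_field \<Rightarrow> 'a vector_field" where
  "field_add X Y = (\<lambda>p f. X p f + Y p f)"

definition field_diff :: "'a vector_field \<Rightarrow> 'a vector_field \<Rightarrow> 'a vector_field" where
  "field_diff X Y = (\<lambda>p f. X p f - Y p f)"

definition field_scale :: "('a \<Rightarrow> real) \<Rightarrow> 'a vector_field \<Rightarrow> 'a vector_field" where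
  "field_scale h X = (\<lambda>p f. h p * X p f)"

definition lie_bracket :: "'a vector_field \<Rightarrow> 'a vector_field \<Rightarrow> 'a vector_field" where
  "lie_bracket X Y = (\<lambda>p f. X p (deriv_along Y f) - Y p (deriv_along X f))"

definition one_form ::
  "('a, 'n::finite) manifold_data \<Rightarrow> ('a vector_field \<Rightarrow> 'a \<Rightarrow> real) \<Rightarrow> bool" where
  "one_form M \<omega> \<longleftrightarrow>
     (\<forall>X\<in>vector_fields M. \<omega> X \<in> smooth_functions M) \<and>
     (\<forall>X\<in>vector_fields M. \<forall>Y\<in>vector_fields M. \<forall>p\<in>points M.
        \<omega> (field_add X Y) p = \<omega> X p + \<omega> Y p) \<and>
     (\<forall>X\<in>vector_fields M. \<forall>h\<in>smooth_functions M. \<forall>p\<in>points M.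
        \<omega> (field_scale h X) p = h p * \<omega> X p)"

definition nonzero_one_form ::
  "('a, 'n::finite) manifold_data \<Rightarrow> ('a vector_field \<Rightarrow> 'a \<Rightarrow> real) \<Rightarrow> bool" where
  "nonzero_one_form M \<omega> \<longleftrightarrow>
     one_form M \<omega> \<and> (\<exists>X\<in>vector_fields M. \<exists>p\<in>points M. \<omega> X p \<noteq> 0)"


section \<open>Riemannian metrics\<close>

type_synonym 'a metric_field = "'a \<Rightarrow> 'a tangent \<Rightarrow> 'a tangent \<Rightarrow> real"

definition metric_apply ::
  "'a metric_field \<Rightarrow> 'a vector_field \<Rightarrow> 'a vector_field \<Rightarrow> 'a \<Rightarrow> real" where
  "metric_apply g X Y = (\<lambda>p. g p (X p) (Y p))"

definition riemannian_manifold :: "('a, 'n::finite) manifold_data \<Rightarrow> 'a metric_field \<Rightarrow> bool" where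
  "riemannian_manifold M g \<longleftrightarrow>
     smooth_manifold M \<and>
     (\<forall>p\<in>points M. \<forall>u\<in>tangent_space M p. \<forall>v\<in>tangent_space M p. g p u v = g p v u) \<and>
     (\<forall>p\<in>points M. \<forall>u\<in>tangent_space M p. \<forall>v\<in>tangent_space M p. \<forall>w\<in>tangent_space M p. \<forall>r s.
        g p (\<lambda>f. r * u f + s * v f) w = r * g p u w + s * g p v w) \<and>
     (\<forall>p\<in>points M. \<forall>u\<in>tangent_space M p. u \<noteq> (\<lambda>f. 0) \<longrightarrow> g p u u > 0) \<and>
     (\<forall>X\<in>vector_fields M. \<forall>Y\<in>vector_fields M. metric_apply g X Y \<in> smooth_functions M)"

text \<open>Vanishing of the Lie derivative of the metric along \<open>X\<close>.\<close>

definition killing_field ::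
  "('a, 'n::finite) manifold_data \<Rightarrow> 'a metric_field \<Rightarrow> 'a vector_field \<Rightarrow> bool" where
  "killing_field M g X \<longleftrightarrow>
     X \<in> vector_fields M \<and>
     (\<forall>Y\<in>vector_fields M. \<forall>Z\<in>vector_fields M. \<forall>p\<in>points M.
        deriv_along X (metric_apply g Y Z) p
          - metric_apply g (lie_bracket X Y) Z p - metric_apply g Y (lie_bracket X Z) p = 0)"


section \<open>Connections and curvature\<close>

type_synonym 'a connection = "'a vector_field \<Rightarrow> 'a vector_field \<Rightarrow> 'a vector_field"

definition affine_connection :: "('a, 'n::finite) manifold_data \<Rightarrow> 'a connection \<Rightarrow> bool" where
  "affine_connection M nabla \<longleftrightarrow>
     (\<forall>X\<in>vector_fields M. \<forall>Y\<in>vector_fields M. nabla X Y \<in> vector_fields M) \<and>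
     (\<forall>X\<in>vector_fields M. \<forall>Y\<in>vector_fields M. \<forall>Z\<in>vector_fields M.
        nabla (field_add X Y) Z = field_add (nabla X Z) (nabla Y Z) \<and>
        nabla X (field_add Y Z) = field_add (nabla X Y) (nabla X Z)) \<and>
     (\<forall>X\<in>vector_fields M. \<forall>Y\<in>vector_fields M. \<forall>h\<in>smooth_functions M.
        nabla (field_scale h X) Y = field_scale h (nabla X Y) \<and>
        nabla X (field_scale h Y) =
          field_add (field_scale (deriv_along X h) Y) (field_scale h (nabla X Y)))"

definition levi_civita_connection ::
  "('a, 'n::finite) manifold_data \<Rightarrow> 'a metric_field \<Rightarrow> 'a connection \<Rightarrow> bool" where
  "levi_civita_connection M g nabla \<longleftrightarrow>
     affine_connection M nabla \<and>
     (\<forall>X\<in>vector_fields M. \<forall>Y\<in>vector_fields M.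
        field_diff (nabla X Y) (nabla Y X) = lie_bracket X Y) \<and>
     (\<forall>X\<in>vector_fields M. \<forall>Y\<in>vector_fields M. \<forall>Z\<in>vector_fields M. \<forall>p\<in>points M.
        deriv_along X (metric_apply g Y Z) p =
          metric_apply g (nabla X Y) Z p + metric_apply g Y (nabla X Z) p)"

definition curvature ::
  "'a connection \<Rightarrow> 'a vector_field \<Rightarrow> 'a vector_field \<Rightarrow> 'a vector_field \<Rightarrow> 'a vector_field" where
  "curvature nabla X Y Z =
     field_diff (field_diff (nabla X (nabla Y Z)) (nabla Y (nabla X Z))) (nabla (lie_bracket X Y) Z)"

definition orthonormal_at ::
  "('a, 'n::finite) manifold_data \<Rightarrow> 'a metric_field \<Rightarrow> 'a \<Rightarrow> ('n \<Rightarrow> 'a vector_field) \<Rightarrow> bool" where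
  "orthonormal_at M g p E \<longleftrightarrow>
     (\<forall>i. E i \<in> vector_fields M) \<and>
     (\<forall>i j. metric_apply g (E i) (E j) p = (if i = j then 1 else 0))"

text \<open>\<open>Ric(Y, Z)\<close> at \<open>p\<close> is the trace of the endomorphism \<open>X \<mapsto> R(X, Y)Z\<close> of the tangent space at \<open>p\<close>,
  computed in an orthonormal basis of that space (its dimension is \<open>CARD('n)\<close>) whose members are
  extended to global vector fields. The extensions exist by means of bump functions, and the value
  depends neither on the extensions, since the curvature is tensorial, nor on the basis.\<close>

definition ricci ::
  "('a, 'n::finite) manifold_data \<Rightarrow> 'a metric_field \<Rightarrow> 'a connection \<Rightarrow>
   'a vector_field \<Rightarrow> 'a vector_field \<Rightarrow> 'a \<Rightarrow> real" where
  "ricci M g nabla Y Z = (\<lambda>p.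
     let E = (SOME E. orthonormal_at M g p E)
     in \<Sum>i\<in>UNIV. metric_apply g (curvature nabla (E i) Y Z) (E i) p)"

definition covariant_derivative ::
  "'a connection \<Rightarrow> ('a vector_field \<Rightarrow> 'a vector_field \<Rightarrow> 'a \<Rightarrow> real) \<Rightarrow>
   'a vector_field \<Rightarrow> 'a vector_field \<Rightarrow> 'a vector_field \<Rightarrow> 'a \<Rightarrow> real" where
  "covariant_derivative nabla S X Y Z = (\<lambda>p.
     deriv_along X (S Y Z) p - S (nabla X Y) Z p - S Y (nabla X Z) p)"


section \<open>Extended quasi-Einstein manifolds\<close>

text \<open>The connection \<open>nabla\<close> is a parameter, characterized as the Levi-Civita connection of \<open>g\<close>.
  The associated scalars are smooth functions here; \<open>c \<noteq> 0\<close> is read pointwise.\<close>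

definition extended_quasi_einstein ::
  "('a, 'n::finite) manifold_data \<Rightarrow> 'a metric_field \<Rightarrow> 'a connection \<Rightarrow>
   ('a \<Rightarrow> real) \<Rightarrow> ('a \<Rightarrow> real) \<Rightarrow> ('a \<Rightarrow> real) \<Rightarrow>
   ('a vector_field \<Rightarrow> 'a \<Rightarrow> real) \<Rightarrow> ('a vector_field \<Rightarrow> 'a \<Rightarrow> real) \<Rightarrow>
   ('a vector_field \<Rightarrow> 'a \<Rightarrow> real) \<Rightarrow>
   'a vector_field \<Rightarrow> 'a vector_field \<Rightarrow> 'a vector_field \<Rightarrow> bool" where
  "extended_quasi_einstein M g nabla a b c A B D U V T \<longleftrightarrow>
     CARD('n) \<ge> 3 \<and> riemannian_manifold M g \<and> levi_civita_connection M g nabla \<and>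
     (\<exists>X\<in>vector_fields M. \<exists>Y\<in>vector_fields M. \<exists>Z\<in>vector_fields M. \<exists>p\<in>points M.
        curvature nabla X Y Z p \<noteq> (\<lambda>f. 0)) \<and>
     (\<exists>Y\<in>vector_fields M. \<exists>Z\<in>vector_fields M. \<exists>p\<in>points M. ricci M g nabla Y Z p \<noteq> 0) \<and>
     a \<in> smooth_functions M \<and> b \<in> smooth_functions M \<and> c \<in> smooth_functions M \<and>
     (\<forall>p\<in>points M. c p \<noteq> 0) \<and>
     U \<in> vector_fields M \<and> V \<in> vector_fields M \<and> T \<in> vector_fields M \<and>
     (\<forall>p\<in>points M. metric_apply g U U p = 1 \<and> metric_apply g V V p = 1 \<and>
        metric_apply g T T p = 1 \<and> metric_apply g U V p = 0 \<and>
        metric_apply g U T p = 0 \<and> metric_apply g V T p = 0) \<and>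
     nonzero_one_form M A \<and> nonzero_one_form M B \<and> nonzero_one_form M D \<and>
     (\<forall>X\<in>vector_fields M. \<forall>p\<in>points M.
        A X p = metric_apply g X U p \<and> B X p = metric_apply g X V p \<and>
        D X p = metric_apply g X T p) \<and>
     (\<forall>X\<in>vector_fields M. \<forall>Y\<in>vector_fields M. \<forall>p\<in>points M.
        ricci M g nabla X Y p =
          a p * metric_apply g X Y p + b p * A X p * A Y p
            + c p * (B X p * D Y p + D X p * B Y p))"

end

theory Submission
  imports Defs
begin

text \<open>For constant \<open>a\<close>, \<open>b\<close>, \<open>c\<close>, metric compatibility turns \<open>(\<nabla>\<^sub>X Ric)(Y, Z)\<close> into a sum of products of
  the values of \<open>A\<close>, \<open>B\<close>, \<open>D\<close> with the bilinear forms \<open>g(\<nabla>\<^sub>X U, Y)\<close>, \<open>g(\<nabla>\<^sub>X V, Y)\<close>, \<open>g(\<nabla>\<^sub>X T, Y)\<close>. The Killing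
  equation says that these forms are skew in \<open>X\<close>, \<open>Y\<close>, so everything cancels in the cyclic sum.\<close>

section \<open>Smooth functions\<close>

text \<open>\<open>frechet_derivative\<close> is a choice among all \<open>F\<close> satisfying
  \<open>has_derivative\<close>. Near \<open>x\<close> both functions admit the same
  \<open>F\<close>, so the choices agree even where neither function is differentiable.\<close>

lemma frechet_derivative_eq_on_open:
  assumes "open S" "x \<in> S" "\<And>y. y \<in> S \<Longrightarrow> f y = h y"
  shows "frechet_derivative f (at x) = frechet_derivative h (at x)"
proof -
  have "(f has_derivative F) (at x) \<longleftrightarrow> (h has_derivative F) (at x)" for F
    using has_derivative_transform_within_open[OF _ assms(1,2)] assms(3) by metis
  then show ?thesis by (simp add: frechet_derivative_def)
qed

lemma differentiable_eq_on_open: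
  assumes "open S" "x \<in> S" "\<And>y. y \<in> S \<Longrightarrow> f y = h y"
  shows "f differentiable (at x) \<longleftrightarrow> h differentiable (at x)"
  unfolding differentiable_def
  using has_derivative_transform_within_open[OF _ assms(1,2)] assms(3) by metis

text \<open>Openness of \<open>S\<close> lets the equality pass to derivatives at points of
  \<open>S\<close>, which feeds the induction; hence \<open>f\<close> and \<open>h\<close> are kept
  arbitrary.\<close>

lemma class_C_cong:
  assumes "open S" "\<And>x. x \<in> S \<Longrightarrow> f x = h x"
  shows "class_C k S f \<longleftrightarrow> class_C k S h"
  using assms(2)
proof (induction k arbitrary: f h)
  case 0
  then show ?case by (simp cong: continuous_on_cong)
next
  case (Suc k)
  have "class_C k S (\<lambda>x. frechet_derivative f (at x) v) \<longleftrightarrow>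
      class_C k S (\<lambda>x. frechet_derivative h (at x) v)" for v
    by (rule Suc.IH) (simp add: frechet_derivative_eq_on_open[OF assms(1) _ Suc.prems])
  then show ?case
    using differentiable_eq_on_open[OF assms(1) _ Suc.prems] by auto
qed

text \<open>At the bottom this is continuity of differentiable functions. It serves the product
  rule, where undifferentiated factors survive in the derivative.\<close>

lemma class_C_SucD: "class_C (Suc k) S f \<Longrightarrow> class_C k S f"
proof (induction k arbitrary: f)
  case 0
  then show ?case
    by (auto intro!: continuous_at_imp_continuous_on differentiable_imp_continuous_within)
next
  case (Suc k)
  show ?case
    unfolding class_C.simps(2)[of k]
  proof (intro conjI allI)
    show "\<forall>x\<in>S. f differentiable (at x)"
      using Suc.prems by simp
  next
    fix v
    have "class_C (Suc k) S (\<lambda>x. frechet_derivative f (at x) v)"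
      using Suc.prems class_C.simps(2)[of "Suc k" S f] by blast
    then show "class_C k S (\<lambda>x. frechet_derivative f (at x) v)"
      by (rule Suc.IH)
  qed
qed

lemma class_C_lincomb:
  fixes f h :: "'b::real_normed_vector \<Rightarrow> real"
  assumes "open S" "class_C k S f" "class_C k S h"
  shows "class_C k S (\<lambda>x. r * f x + s * h x)"
  using assms(2,3)
proof (induction k arbitrary: f h)
  case 0
  then show ?case by (auto intro!: continuous_intros)
next
  case (Suc k)
  have diff: "f differentiable (at x)" "h differentiable (at x)" if "x \<in> S" for x
    using Suc.prems that by auto
  have "frechet_derivative (\<lambda>x. r * f x + s * h x) (at x) v =
      r * frechet_derivative f (at x) v + s * frechet_derivative h (at x) v" if "x \<in> S" for x v
  proof -
    have "((\<lambda>x. r * f x + s * h x) has_derivative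
        (\<lambda>v. r * frechet_derivative f (at x) v + s * frechet_derivative h (at x) v)) (at x)"
      using diff[OF that] by (auto intro!: derivative_intros simp: frechet_derivative_works[symmetric])
    then show ?thesis by (simp add: frechet_derivative_at[symmetric])
  qed
  moreover have "class_C k S (\<lambda>x. r * frechet_derivative f (at x) v + s * frechet_derivative h (at x) v)" for v
    using Suc by auto
  ultimately show ?case
    using diff by (simp cong: class_C_cong[OF assms(1)])
qed

lemma class_C_mult:
  fixes f h :: "'b::real_normed_vector \<Rightarrow> real"
  assumes "open S" "class_C k S f" "class_C k S h"
  shows "class_C k S (\<lambda>x. f x * h x)"
  using assms(2,3)
proof (induction k arbitrary: f h)
  case 0
  then show ?case by (auto intro!: continuous_intros)
next
  case (Suc k)
  have diff: "f differentiable (at x)" "h differentiable (at x)" if "x \<in> S" for x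
    using Suc.prems that by auto
  have "frechet_derivative (\<lambda>x. f x * h x) (at x) v =
      1 * (f x * frechet_derivative h (at x) v) + 1 * (frechet_derivative f (at x) v * h x)"
    if "x \<in> S" for x v
  proof -
    have "((\<lambda>x. f x * h x) has_derivative
        (\<lambda>v. f x * frechet_derivative h (at x) v + frechet_derivative f (at x) v * h x)) (at x)"
      using diff[OF that] by (intro has_derivative_mult) (auto simp: frechet_derivative_works[symmetric])
    then show ?thesis by (simp add: frechet_derivative_at[symmetric])
  qed
  moreover have "class_C k S (\<lambda>x. 1 * (f x * frechet_derivative h (at x) v) +
      1 * (frechet_derivative f (at x) v * h x))" for v
    using Suc class_C_SucD[OF Suc.prems(1)] class_C_SucD[OF Suc.prems(2)]
    by (intro class_C_lincomb[OF assms(1)]) auto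
  ultimately show ?case
    using diff by (simp cong: class_C_cong[OF assms(1)])
qed

section \<open>Transfer from chart images to the manifold\<close>

lemma smooth_manifold_chart:
  assumes "smooth_manifold M" "(W, \<phi>) \<in> atlas M"
  shows "open (\<phi> ` W)" "W \<subseteq> points M"
proof -
  have "\<forall>(W, \<phi>)\<in>atlas M. openin (base M) W \<and> open (\<phi> ` W) \<and>
      homeomorphic_map (subtopology (base M) W) (top_of_set (\<phi> ` W)) \<phi>"
    using assms(1) unfolding smooth_manifold_def by (elim conjE)
  then have "openin (base M) W \<and> open (\<phi> ` W)"
    using assms(2) by blast
  then show "open (\<phi> ` W)" "W \<subseteq> points M"
    using openin_subset by auto
qed

lemma smooth_functions_lincomb:
  assumes "smooth_manifold M" "f \<in> smooth_functions M" "h \<in> smooth_functions M"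
  shows "(\<lambda>q. r * f q + s * h q) \<in> smooth_functions M"
  using assms(2,3) class_C_lincomb[OF smooth_manifold_chart(1)[OF assms(1)]]
  unfolding smooth_functions_def smooth_map_on_def o_def by blast

lemma smooth_functions_mult:
  assumes "smooth_manifold M" "f \<in> smooth_functions M" "h \<in> smooth_functions M"
  shows "(\<lambda>q. f q * h q) \<in> smooth_functions M"
  using assms(2,3) class_C_mult[OF smooth_manifold_chart(1)[OF assms(1)]]
  unfolding smooth_functions_def smooth_map_on_def o_def by blast

lemma smooth_functions_cong:
  assumes "smooth_manifold M" "\<And>q. q \<in> points M \<Longrightarrow> f q = h q" "f \<in> smooth_functions M"
  shows "h \<in> smooth_functions M"
proof -
  have "smooth_map_on (\<phi> ` W) (h \<circ> inv_into W \<phi>)" if W: "(W, \<phi>) \<in> atlas M" for W \<phi>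
  proof -
    note chart = smooth_manifold_chart[OF assms(1) W]
    have "class_C k (\<phi> ` W) (h \<circ> inv_into W \<phi>) \<longleftrightarrow> class_C k (\<phi> ` W) (f \<circ> inv_into W \<phi>)" for k
      by (rule class_C_cong[OF chart(1)])
        (metis assms(2) chart(2) comp_apply inv_into_into subsetD)
    then show ?thesis
      using assms(3) W by (auto simp: smooth_functions_def smooth_map_on_def)
  qed
  then show ?thesis by (auto simp: smooth_functions_def)
qed


section \<open>Tangent vectors\<close>

lemma tangent_lincomb:
  assumes "v \<in> tangent_space M p" "f \<in> smooth_functions M" "h \<in> smooth_functions M"
  shows "v (\<lambda>q. r * f q + s * h q) = r * v f + s * v h"
  using assms unfolding tangent_space_def by blast

lemma tangent_mult:
  assumes "v \<in> tangent_space M p" "f \<in> smooth_functions M" "h \<in> smooth_functions M"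
  shows "v (\<lambda>q. f q * h q) = f p * v h + h p * v f"
  using assms unfolding tangent_space_def by blast

lemma tangent_zero_if_vanishing:
  assumes "smooth_manifold M" "p \<in> points M" "v \<in> tangent_space M p"
    and "f \<in> smooth_functions M" "\<And>q. q \<in> points M \<Longrightarrow> f q = 0"
  shows "v f = 0"
proof -
  \<comment> \<open>The indicator of the complement agrees with \<open>f\<close> on the manifold,
    hence is smooth. Since \<open>f\<close> equals \<open>f * h\<close> everywhere and both factors
    vanish at \<open>p\<close>, the product rule gives 0.\<close>
  define h :: "_ \<Rightarrow> real" where "h = (\<lambda>q. if q \<in> points M then 0 else 1)"
  have "h \<in> smooth_functions M"
    by (rule smooth_functions_cong[OF assms(1) _ assms(4)]) (simp add: h_def assms(5))
  moreover have "f = (\<lambda>q. f q * h q)"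
    using assms(5) by (auto simp: h_def)
  ultimately have "v f = f p * v h + h p * v f"
    using tangent_mult[OF assms(3,4)] by metis
  then show ?thesis
    using assms(2,5) by (simp add: h_def)
qed

text \<open>Needed because tangent vectors act on functions on the whole type, while the formula for
  the Ricci tensor holds only at points of \<open>M\<close>.\<close>

lemma tangent_cong:
  assumes "smooth_manifold M" "p \<in> points M" "v \<in> tangent_space M p"
    and "f \<in> smooth_functions M" "\<And>q. q \<in> points M \<Longrightarrow> f q = h q"
  shows "v f = v h"
proof -
  have h: "h \<in> smooth_functions M"
    using smooth_functions_cong[OF assms(1,5,4)] by blast
  have "v (\<lambda>q. 1 * f q + (-1) * h q) = 0"
    by (rule tangent_zero_if_vanishing[OF assms(1-3) smooth_functions_lincomb[OF assms(1,4) h]])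
      (simp add: assms(5))
  then show ?thesis
    using tangent_lincomb[OF assms(3,4) h, of 1 "-1"] by simp
qed


section \<open>Killing fields\<close>

lemma vector_fields_tangent:
  "X \<in> vector_fields M \<Longrightarrow> p \<in> points M \<Longrightarrow> X p \<in> tangent_space M p"
  by (simp add: vector_fields_def)

lemma metric_commute:
  assumes "riemannian_manifold M g" "p \<in> points M" "u \<in> tangent_space M p" "v \<in> tangent_space M p"
  shows "g p u v = g p v u"
  using assms(1) unfolding riemannian_manifold_def by (elim conjE) (simp add: assms(2-4))

lemma metric_linear_left:
  assumes "riemannian_manifold M g" "p \<in> points M"
    and "u \<in> tangent_space M p" "v \<in> tangent_space M p" "w \<in> tangent_space M p"
  shows "g p (\<lambda>f. r * u f + s * v f) w = r * g p u w + s * g p v w"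
  using assms(1) unfolding riemannian_manifold_def by (elim conjE) (simp add: assms(2-5))

lemma metric_apply_commute:
  assumes "riemannian_manifold M g" "X \<in> vector_fields M" "Y \<in> vector_fields M" "p \<in> points M"
  shows "metric_apply g X Y p = metric_apply g Y X p"
  unfolding metric_apply_def by (intro metric_commute[OF assms(1)] vector_fields_tangent assms)

lemma metric_apply_diff_left:
  assumes "riemannian_manifold M g" "X \<in> vector_fields M" "Y \<in> vector_fields M"
    "Z \<in> vector_fields M" "p \<in> points M"
  shows "metric_apply g (field_diff X Y) Z p = metric_apply g X Z p - metric_apply g Y Z p"
proof -
  have "g p (\<lambda>f. 1 * X p f + (-1) * Y p f) (Z p) = 1 * g p (X p) (Z p) + (-1) * g p (Y p) (Z p)"
    by (intro metric_linear_left[OF assms(1)] vector_fields_tangent assms)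
  then show ?thesis by (simp add: metric_apply_def field_diff_def)
qed

text \<open>Symmetry of the metric is a pointwise statement about tangent vectors, so tangency of
  the difference at \<open>p\<close> suffices to move it to the second argument.\<close>

lemma field_diff_tangent:
  assumes "X \<in> vector_fields M" "Y \<in> vector_fields M" "p \<in> points M"
  shows "field_diff X Y p \<in> tangent_space M p"
  using vector_fields_tangent[OF assms(1,3)] vector_fields_tangent[OF assms(2,3)]
  unfolding tangent_space_def field_diff_def by (simp add: algebra_simps)

lemma metric_apply_diff_right:
  assumes "riemannian_manifold M g" "X \<in> vector_fields M" "Y \<in> vector_fields M"
    "Z \<in> vector_fields M" "p \<in> points M"
  shows "metric_apply g Z (field_diff X Y) p = metric_apply g Z X p - metric_apply g Z Y p"
proof -
  have "field_diff X Y p \<in> tangent_space M p"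
    by (intro field_diff_tangent assms)
  then have "metric_apply g Z (field_diff X Y) p = metric_apply g (field_diff X Y) Z p"
    unfolding metric_apply_def
    using metric_commute[OF assms(1,5)] vector_fields_tangent[OF assms(4,5)] by blast
  then show ?thesis
    using metric_apply_diff_left[OF assms] metric_apply_commute[OF assms(1) _ assms(4,5)] assms(2,3)
    by simp
qed

lemma metric_apply_smooth:
  assumes "riemannian_manifold M g" "X \<in> vector_fields M" "Y \<in> vector_fields M"
  shows "metric_apply g X Y \<in> smooth_functions M"
  using assms(1) unfolding riemannian_manifold_def by (elim conjE) (simp add: assms(2,3))

section \<open>The Levi-Civita connection and the Killing equation\<close>

lemma levi_civita_in_vector_fields:
  assumes "levi_civita_connection M g nabla" "X \<in> vector_fields M" "Y \<in> vector_fields M"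
  shows "nabla X Y \<in> vector_fields M"
  using assms(1) unfolding levi_civita_connection_def affine_connection_def
  by (elim conjE) (simp add: assms(2,3))

lemma levi_civita_torsion_free:
  assumes "levi_civita_connection M g nabla" "X \<in> vector_fields M" "Y \<in> vector_fields M"
  shows "lie_bracket X Y = field_diff (nabla X Y) (nabla Y X)"
  using assms(1) unfolding levi_civita_connection_def by (elim conjE) (simp add: assms(2,3))

lemma levi_civita_metric:
  assumes "levi_civita_connection M g nabla" "X \<in> vector_fields M" "Y \<in> vector_fields M"
    "Z \<in> vector_fields M" "p \<in> points M"
  shows "X p (metric_apply g Y Z) = metric_apply g (nabla X Y) Z p + metric_apply g Y (nabla X Z) p"
  using assms(1) unfolding levi_civita_connection_def deriv_along_def
  by (elim conjE) (simp add: assms(2-5))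

text \<open>Torsion-freeness replaces the Lie brackets in the Killing equation by covariant
  derivatives. By metric compatibility the terms with \<open>nabla K X\<close> and
  \<open>nabla K Y\<close> cancel against the derivative of \<open>g(X, Y)\<close> along
  \<open>K\<close>.\<close>

lemma killing_field_skew:
  assumes R: "riemannian_manifold M g" and L: "levi_civita_connection M g nabla"
    and K: "killing_field M g K"
    and X: "X \<in> vector_fields M" and Y: "Y \<in> vector_fields M" and p: "p \<in> points M"
  shows "metric_apply g X (nabla Y K) p = - metric_apply g Y (nabla X K) p"
proof -
  have KF: "K \<in> vector_fields M"
    using K by (simp add: killing_field_def)
  note N = levi_civita_in_vector_fields[OF L]
  have "K p (metric_apply g X Y) - metric_apply g (lie_bracket K X) Y p
      - metric_apply g X (lie_bracket K Y) p = 0"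
    using K X Y p by (simp add: killing_field_def deriv_along_def)
  moreover have "metric_apply g (lie_bracket K X) Y p =
      metric_apply g (nabla K X) Y p - metric_apply g (nabla X K) Y p"
    using X Y KF p by (simp add: levi_civita_torsion_free[OF L] metric_apply_diff_left[OF R] N)
  moreover have "metric_apply g X (lie_bracket K Y) p =
      metric_apply g X (nabla K Y) p - metric_apply g X (nabla Y K) p"
    using X Y KF p by (simp add: levi_civita_torsion_free[OF L] metric_apply_diff_right[OF R] N)
  ultimately show ?thesis
    using levi_civita_metric[OF L KF X Y p] metric_apply_commute[OF R N[OF X KF] Y p] by linarith
qed

section \<open>The cyclic sum for the Ricci tensor\<close>

theorem theorem2p4:
  fixes M :: "('a, 'n::finite) manifold_data"
    and g :: "'a metric_field"
    and nabla :: "'a connection"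
    and a b c :: "'a \<Rightarrow> real"
    and A B D :: "'a vector_field \<Rightarrow> 'a \<Rightarrow> real"
    and U V T :: "'a vector_field"
  assumes "extended_quasi_einstein M g nabla a b c A B D U V T"
    and "a constant_on points M" and "b constant_on points M" and "c constant_on points M"
    and "killing_field M g U" and "killing_field M g V" and "killing_field M g T"
  shows "\<forall>X\<in>vector_fields M. \<forall>Y\<in>vector_fields M. \<forall>Z\<in>vector_fields M. \<forall>p\<in>points M.
    covariant_derivative nabla (ricci M g nabla) X Y Z p
      + covariant_derivative nabla (ricci M g nabla) Y Z X p
      + covariant_derivative nabla (ricci M g nabla) Z X Y p = 0"
proof (intro ballI)
  have R: "riemannian_manifold M g" and L: "levi_civita_connection M g nabla"
    and UVT: "U \<in> vector_fields M" "V \<in> vector_fields M" "T \<in> vector_fields M"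
    using assms(1) unfolding extended_quasi_einstein_def by auto
  have sm: "smooth_manifold M"
    using R by (simp add: riemannian_manifold_def)
  obtain a0 b0 c0 where abc: "\<And>q. q \<in> points M \<Longrightarrow> a q = a0 \<and> b q = b0 \<and> c q = c0"
    using assms(2-4) unfolding constant_on_def by metis
  note N = levi_civita_in_vector_fields[OF L]
  let ?G = "metric_apply g"
  have ric: "ricci M g nabla X Y q = a0 * ?G X Y q + b0 * (?G X U q * ?G Y U q)
      + c0 * (?G X V q * ?G Y T q + ?G X T q * ?G Y V q)"
    if "X \<in> vector_fields M" "Y \<in> vector_fields M" "q \<in> points M" for X Y q
    using assms(1) that abc[OF that(3)] unfolding extended_quasi_einstein_def by simp
  \<comment> \<open>No term in \<open>a0\<close> remains, since the metric is parallel; only terms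
    in which a generator is differentiated survive.\<close>
  have cov: "covariant_derivative nabla (ricci M g nabla) X Y Z p =
      b0 * (?G Y (nabla X U) p * ?G Z U p + ?G Y U p * ?G Z (nabla X U) p)
      + c0 * (?G Y (nabla X V) p * ?G Z T p + ?G Y V p * ?G Z (nabla X T) p
        + ?G Y (nabla X T) p * ?G Z V p + ?G Y T p * ?G Z (nabla X V) p)"
    if X: "X \<in> vector_fields M" and Y: "Y \<in> vector_fields M" and Z: "Z \<in> vector_fields M"
      and p: "p \<in> points M" for X Y Z p
  proof -
    note XT = vector_fields_tangent[OF X p]
    note S = metric_apply_smooth[OF R] smooth_functions_mult[OF sm] smooth_functions_lincomb[OF sm]
    \<comment> \<open>The right side of \<open>ric\<close>, bracketed into binary combinations with
      explicit coefficients so that the linearity and product rules match it syntactically.\<close>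
    let ?f = "\<lambda>q. 1 * (a0 * ?G Y Z q + b0 * (?G Y U q * ?G Z U q))
        + c0 * (1 * (?G Y V q * ?G Z T q) + 1 * (?G Y T q * ?G Z V q))"
    have "?f \<in> smooth_functions M"
      by (intro S UVT Y Z)
    then have "X p (ricci M g nabla Y Z) = X p ?f"
      by (intro tangent_cong[OF sm p XT, symmetric]) (simp_all add: ric Y Z)
    also have "\<dots> = a0 * X p (?G Y Z) + b0 * (?G Y U p * X p (?G Z U) + ?G Z U p * X p (?G Y U))
        + c0 * (?G Y V p * X p (?G Z T) + ?G Z T p * X p (?G Y V)
          + ?G Y T p * X p (?G Z V) + ?G Z V p * X p (?G Y T))"
      by (simp only: tangent_lincomb[OF XT] tangent_mult[OF XT] S UVT Y Z) (simp add: algebra_simps)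
    \<comment> \<open>Metric compatibility splits each \<open>X p (?G Y K)\<close> into
      \<open>?G (nabla X Y) K p\<close> and \<open>?G Y (nabla X K) p\<close>. Subtracting the Ricci
      terms at \<open>nabla X Y\<close> and \<open>nabla X Z\<close> removes the first kind.\<close>
    finally show ?thesis
      unfolding covariant_derivative_def deriv_along_def
      by (simp add: ric N X Y Z p UVT levi_civita_metric[OF L] algebra_simps)
  qed
  fix X Y Z p
  assume *: "X \<in> vector_fields M" "Y \<in> vector_fields M" "Z \<in> vector_fields M" "p \<in> points M"
  \<comment> \<open>One rule for each unordered pair from \<open>X\<close>, \<open>Y\<close>,
    \<open>Z\<close>, oriented so that a single representative per pair remains after rewriting. No
    diagonal term such as \<open>?G X (nabla X K) p\<close> occurs in the cyclic sum.\<close>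
  have skew: "?G X (nabla Y K) p = - ?G Y (nabla X K) p"
      "?G Z (nabla Y K) p = - ?G Y (nabla Z K) p" "?G X (nabla Z K) p = - ?G Z (nabla X K) p"
    if "killing_field M g K" for K
    using killing_field_skew[OF R L that] * by blast+
  show "covariant_derivative nabla (ricci M g nabla) X Y Z p
      + covariant_derivative nabla (ricci M g nabla) Y Z X p
      + covariant_derivative nabla (ricci M g nabla) Z X Y p = 0"
    by (simp add: cov * skew[OF assms(5)] skew[OF assms(6)] skew[OF assms(7)] algebra_simps)
qed

end
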